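(* Let $E$ be a nonzero real Banach space, let $e^{**} \in E^{**} \setminus \widehat{E}$, and let $T : E^* \to E^{**}$ be a linear map such that $R(T) \subset \widehat{E}$ and $$\langle x^*, Tx^*\rangle = \langle x^*, e^{**}\rangle^2 \quad \text{for all } x^* \in E^*.$$ Define $S : E \rightrightarrows E^*$ by $x^* \in Sx \iff \widehat{x} = Tx^*$. Then: (a) $S$ is maximally monotone and quasidense, and $S^{\mathbb F} = T$. (b) $S^{\mathbb F}$ is maximally monotone but not quasidense.
   Context: $\widehat{x}$ is the canonical image of $x \in E$ in $E^{**}$ and $\widehat{E} := \{\widehat{x} : x \in E\}$; $R(T)$ is the range of $T$. For a nonzero real Banach space $F$ and a multifunction $U : F \rightrightarrows F^*$, $G(U) := \{(x,x^* ) : x^* \in Ux\}$ is its graph; $U$ is maximally monotone if $G(U)$ is a maximally monotone subset of $F \times F^*$, and quasidense if, for all $(x,x^* ) \in F \times F^*$, $\inf_{(s,s^* ) \in G(U)}\big[\frac12\|s-x\|^2 + \frac12\|s^*-x^*\|^2 + \langle s-x, s^*-x^*\rangle\big] \le 0$. These notions are used with $F = E$ for $S$ and with $F = E^*$, $F^* = E^{**}$ for $S^{\mathbb F}$. For a closed (i.e. with norm-closed graph), quasidense, monotone $S : E \rightrightarrows E^*$, let $\varphi_S(x,x^* ) := \sup_{(s,s^* ) \in G(S)}[\langle s, x^*\rangle + \langle x, s^*\rangle - \langle s, s^*\rangle]$ and ${\varphi_S}^*(y^*,y^{**}) := \sup_{(x,x^* ) \in E \times E^*}[\langle x, y^*\rangle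 + \langle x^*, y^{**}\rangle - \varphi_S(x,x^* )]$; the Fitzpatrick extension $S^{\mathbb F} : E^* \rightrightarrows E^{**}$ is the multifunction with graph $G(S^{\mathbb F}) := \{(y^*,y^{**}) \in E^* \times E^{**} : {\varphi_S}^*(y^*,y^{**}) = \langle y^*, y^{**}\rangle\}$. *)

theory Defs
  imports "HOL-Analysis.Analysis"
begin

text \<open>
  The dual of a real Banach space \<open>'a\<close> is the type \<open>'a \<Rightarrow>\<^sub>L real\<close> with its operator norm,
  the bidual is \<open>('a \<Rightarrow>\<^sub>L real) \<Rightarrow>\<^sub>L real\<close>, and the pairing of \<open>x\<close> with \<open>x'\<close> is
  \<open>blinfun_apply x' x\<close>.  Multifunctions are set-valued functions.
\<close>

lift_definition canonical_image :: "'a::real_normed_vector \<Rightarrow> (('a \<Rightarrow>\<^sub>L real) \<Rightarrow>\<^sub>L real)"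
  is "\<lambda>x x'. blinfun_apply x' x"
  by (rule blinfun.bounded_linear_left)

definition multi_graph :: "('a \<Rightarrow> 'b set) \<Rightarrow> ('a \<times> 'b) set" where
  "multi_graph U = {(x, x'). x' \<in> U x}"

definition monotone_subset :: "('a::banach \<times> ('a \<Rightarrow>\<^sub>L real)) set \<Rightarrow> bool" where
  "monotone_subset A \<longleftrightarrow>
     (\<forall>(s, s') \<in> A. \<forall>(t, t') \<in> A. 0 \<le> blinfun_apply (s' - t') (s - t))"

definition maximally_monotone_subset :: "('a::banach \<times> ('a \<Rightarrow>\<^sub>L real)) set \<Rightarrow> bool" where
  "maximally_monotone_subset A \<longleftrightarrow>
     monotone_subset A \<and> (\<forall>B. monotone_subset B \<and> A \<subseteq> B \<longrightarrow> B = A)"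

definition maximally_monotone :: "('a::banach \<Rightarrow> ('a \<Rightarrow>\<^sub>L real) set) \<Rightarrow> bool" where
  "maximally_monotone U \<longleftrightarrow> maximally_monotone_subset (multi_graph U)"

text \<open>
  Infima and suprema are taken in the extended reals; in particular the infimum over an
  empty graph is \<open>\<infinity>\<close>, so a multifunction with empty graph is not quasidense.
\<close>

definition quasidense :: "('a::banach \<Rightarrow> ('a \<Rightarrow>\<^sub>L real) set) \<Rightarrow> bool" where
  "quasidense U \<longleftrightarrow>
     (\<forall>x x'. (INF (s, s') \<in> multi_graph U.
        ereal (1/2 * (norm (s - x))\<^sup>2 + 1/2 * (norm (s' - x'))\<^sup>2
               + blinfun_apply (s' - x') (s - x))) \<le> 0)"

definition fitzpatrick :: "('a::banach \<Rightarrow> ('a \<Rightarrow>\<^sub>L real) set) \<Rightarrow> 'a \<times> ('a \<Rightarrow>\<^sub>L real) \<Rightarrow> ereal" where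
  "fitzpatrick S = (\<lambda>(x, x'). SUP (s, s') \<in> multi_graph S.
     ereal (blinfun_apply x' s + blinfun_apply s' x - blinfun_apply s' s))"

definition conjugate ::
  "('a::banach \<times> ('a \<Rightarrow>\<^sub>L real) \<Rightarrow> ereal) \<Rightarrow>
     ('a \<Rightarrow>\<^sub>L real) \<times> (('a \<Rightarrow>\<^sub>L real) \<Rightarrow>\<^sub>L real) \<Rightarrow> ereal" where
  "conjugate f = (\<lambda>(y', y''). SUP (x, x') \<in> UNIV.
     ereal (blinfun_apply y' x + blinfun_apply y'' x') - f (x, x'))"

text \<open>
  The Fitzpatrick extension is only of interest for closed, quasidense, monotone \<open>S\<close>; the
  formula below makes sense for every \<open>S\<close> and is used as a total definition.
\<close>

definition fitzpatrick_extension ::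
  "('a::banach \<Rightarrow> ('a \<Rightarrow>\<^sub>L real) set) \<Rightarrow>
     ('a \<Rightarrow>\<^sub>L real) \<Rightarrow> (('a \<Rightarrow>\<^sub>L real) \<Rightarrow>\<^sub>L real) set" where
  "fitzpatrick_extension S y' =
     {y''. conjugate (fitzpatrick S) (y', y'') = ereal (blinfun_apply y'' y')}"

end

theory Submission
  imports Defs
begin

text \<open>
  Everything rests on two features of \<open>T\<close>: its quadratic form \<open>x' \<mapsto> (T x') x' = (e x')\<^sup>2\<close> is
  nonnegative, and its values are canonical images, \<open>T x' = canonical_image (t x')\<close> for a linear
  \<open>t\<close> from the dual into the space.  The graph of \<open>S\<close> is then the set of pairs \<open>(t x', x')\<close>.

  Nonnegativity makes both \<open>S\<close> and \<open>T\<close> monotone.  A point monotonically related to such a linear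
  graph gives, along each line through the graph point with the same dual (respectively primal)
  coordinate, a quadratic polynomial \<open>r a + r\<^sup>2 b\<close> that is never negative; hence \<open>a = 0\<close>, which
  says that the point lies on the graph.  The same argument identifies the
  Fitzpatrick extension of \<open>S\<close>: restricting the supremum in the conjugate to the graph of \<open>S\<close>
  already forces \<open>y'' = T y'\<close>, and the reverse inequality comes from a single graph point.

  Quasidensity of \<open>S\<close> (\<open>quasidense_inverse_linear\<close>) asks that an infimum of a convex
  function over the dual be at most \<open>0\<close>.  Fenchel duality for the summand
  \<open>1/2 \<parallel>w + t z\<parallel>\<^sup>2\<close> (\<open>fenchel_norm_square\<close>) bounds the infimum by a dual expression in some \<open>y'\<close>
  and all \<open>z\<close>.  Because the dual variable \<open>y'\<close> lives in the same space as \<open>z\<close>, one may put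
  \<open>z = - y'\<close>, and then all terms cancel.  The duality and the isometry of the canonical embedding
  both come from one Hahn-Banach type statement, \<open>convex_subgradient\<close>.

  For \<open>T\<close> this choice of \<open>z\<close> is unavailable: \<open>T\<close> maps into the bidual, so the dual variable
  would lie in the third dual.  Indeed the range of \<open>T\<close> stays in the canonical copy
  of the space, which is closed and misses \<open>e\<close>.  Hence some \<open>u\<close> makes \<open>e - u\<close> further from
  this copy than the norm of \<open>u\<close>, by a definite amount
  (\<open>far_point_from_closed_subspace\<close>), and at the point \<open>(0, e - u)\<close>
  the infimum defining quasidensity is at least \<open>1/4\<close>.
\<close>

section \<open>Subgradients of convex functions\<close>

text \<open>
  The members of the chain nearly attaining the infimum at \<open>x\<close> and at \<open>y\<close> may differ, but the
  smaller of the two serves both points.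
\<close>
lemma chain_Inf_convex:
  fixes C :: "('v::real_vector \<Rightarrow> real) set"
  assumes ne: "C \<noteq> {}"
    and convex: "\<And>f. f \<in> C \<Longrightarrow> convex_on UNIV f"
    and chain: "\<And>f g. f \<in> C \<Longrightarrow> g \<in> C \<Longrightarrow> f \<le> g \<or> g \<le> f"
    and bdd: "\<And>x. bdd_below ((\<lambda>f. f x) ` C)"
  shows "convex_on UNIV (\<lambda>x. INF f\<in>C. f x)"
proof (rule convex_onI)
  fix t :: real and x y :: 'v
  assume t: "0 < t" "t < 1"
  let ?g = "\<lambda>x. INF f\<in>C. f x" and ?z = "(1 - t) *\<^sub>R x + t *\<^sub>R y"
  have mix: "?g ?z \<le> (1 - t) * f1 x + t * f2 y" if f: "f1 \<in> C" "f2 \<in> C" for f1 f2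
  proof -
    obtain f where f: "f \<in> C" "f \<le> f1" "f \<le> f2"
      using chain[OF f] f by blast
    have "?g ?z \<le> f ?z"
      using bdd f(1) by (rule cINF_lower)
    also have "\<dots> \<le> (1 - t) * f x + t * f y"
      using convex_onD[OF convex[OF f(1)], of t x y] t by simp
    also have "\<dots> \<le> (1 - t) * f1 x + t * f2 y"
      using f(2,3) t by (intro add_mono mult_left_mono) (auto simp: le_fun_def)
    finally show ?thesis .
  qed
  have "(?g ?z - t * f2 y) / (1 - t) \<le> ?g x" if "f2 \<in> C" for f2
    using ne mix[OF _ that] t by (intro cINF_greatest) (auto simp: field_simps)
  then have "(?g ?z - (1 - t) * ?g x) / t \<le> ?g y"
    using ne t by (intro cINF_greatest) (auto simp: field_simps)
  then show "?g ?z \<le> (1 - t) * ?g x + t * ?g y"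
    using t by (simp add: field_simps)
qed simp

text \<open>
  For \<open>0 < t \<le> 1\<close> the rescaling \<open>h (t x) / t\<close> is a convex minorant of \<open>h\<close>, so minimality makes \<open>h\<close>
  positively homogeneous, hence subadditive.  Then \<open>h (x + y) - h y\<close> is, as a function of \<open>x\<close>,
  another convex minorant, and minimality makes \<open>h\<close> additive.
\<close>
lemma minimal_convex_linear:
  fixes h :: "'v::real_vector \<Rightarrow> real"
  assumes convex: "convex_on UNIV h" and zero: "h 0 = 0"
    and minimal: "\<And>g. convex_on UNIV g \<Longrightarrow> g 0 = 0 \<Longrightarrow> g \<le> h \<Longrightarrow> g = h"
  shows "linear h"
proof -
  have scale01: "h (t *\<^sub>R x) = t * h x" if t: "0 < t" "t \<le> 1" for t x
  proof -
    let ?g = "\<lambda>x. h (t *\<^sub>R x) / t"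
    have "convex_on UNIV ?g"
    proof (rule convex_onI)
      fix r :: real and x y :: 'v
      assume r: "0 < r" "r < 1"
      have "h (t *\<^sub>R ((1 - r) *\<^sub>R x + r *\<^sub>R y)) \<le> (1 - r) * h (t *\<^sub>R x) + r * h (t *\<^sub>R y)"
        using convex_onD[OF convex, of r "t *\<^sub>R x" "t *\<^sub>R y"] r
        by (simp add: scaleR_add_right mult.commute)
      then show "?g ((1 - r) *\<^sub>R x + r *\<^sub>R y) \<le> (1 - r) * ?g x + r * ?g y"
        using t by (simp add: field_simps)
    qed simp
    moreover have "?g \<le> h"
      using convex_onD[OF convex, of t 0] t zero by (auto simp: le_fun_def field_simps)
    ultimately have "?g = h"
      using minimal zero by simp
    then show ?thesis
      using t by (metis mult.commute less_irrefl nonzero_eq_divide_eq)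
  qed
  have scale: "h (t *\<^sub>R x) = t * h x" if t: "0 < t" for t x
  proof (cases "t \<le> 1")
    case False
    then show ?thesis
      using scale01[of "1 / t" "t *\<^sub>R x"] by (simp add: field_simps)
  qed (use scale01 t in auto)
  have subadd: "h (x + y) \<le> h x + h y" for x y
    using convex_onD[OF convex, of "1/2" "2 *\<^sub>R x" "2 *\<^sub>R y"] scale[of 2] by simp
  have add: "h (x + y) = h x + h y" for x y
  proof -
    let ?g = "\<lambda>x. h (x + y) - h y"
    have "convex_on UNIV ?g"
    proof (rule convex_onI)
      fix r :: real and a b :: 'v
      assume r: "0 < r" "r < 1"
      have "h (((1 - r) *\<^sub>R a + r *\<^sub>R b) + y) = h ((1 - r) *\<^sub>R (a + y) + r *\<^sub>R (b + y))"
        by (simp add: algebra_simps)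
      also have "\<dots> \<le> (1 - r) * h (a + y) + r * h (b + y)"
        using convex_onD[OF convex, of r "a + y" "b + y"] r by simp
      finally show "?g ((1 - r) *\<^sub>R a + r *\<^sub>R b) \<le> (1 - r) * ?g a + r * ?g b"
        by (simp add: algebra_simps)
    qed simp
    moreover have "?g \<le> h"
      using subadd by (auto simp: le_fun_def algebra_simps)
    ultimately have "?g = h"
      using minimal zero by simp
    then show ?thesis by (metis diff_add_cancel)
  qed
  have neg: "h (- x) = - h x" for x
    using add[of x "- x"] zero by simp
  show ?thesis
  proof (rule linearI)
    fix r x
    show "h (r *\<^sub>R x) = r *\<^sub>R h x"
      using scale[of r x] scale[of "- r" x] zero neg[of "r *\<^sub>R x"]
      by (cases r "0::real" rule: linorder_cases) auto
  qed (rule add)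
qed

text \<open>
  An algebraic form of the Hahn-Banach theorem.  By Zorn's lemma there is a minimal convex function
  vanishing at \<open>0\<close> below \<open>v \<mapsto> H (u + v) - H u\<close>; it is linear by the preceding lemma.
  Working with convex rather than sublinear functions avoids both directional derivatives and
  extensions from subspaces.
\<close>
theorem convex_subgradient:
  fixes H :: "'v::real_vector \<Rightarrow> real"
  assumes "convex_on UNIV H"
  obtains L where "linear L" "\<And>v. H u + L (v - u) \<le> H v"
proof -
  let ?K = "\<lambda>v. H (u + v) - H u"
  let ?A = "{h. convex_on UNIV h \<and> h 0 = 0 \<and> h \<le> ?K}"
  let ?R = "relation_of (\<lambda>f g. g \<le> f) ?A"
  have K: "?K \<in> ?A"
  proof -
    have "convex_on UNIV ?K"
    proof (rule convex_onI)
      fix r :: real and a b :: 'v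
      assume r: "0 < r" "r < 1"
      have "H (u + ((1 - r) *\<^sub>R a + r *\<^sub>R b)) = H ((1 - r) *\<^sub>R (u + a) + r *\<^sub>R (u + b))"
        by (simp add: algebra_simps)
      also have "\<dots> \<le> (1 - r) * H (u + a) + r * H (u + b)"
        using convex_onD[OF assms, of r "u + a" "u + b"] r by simp
      finally show "?K ((1 - r) *\<^sub>R a + r *\<^sub>R b) \<le> (1 - r) * ?K a + r * ?K b"
        by (simp add: algebra_simps)
    qed simp
    then show ?thesis by simp
  qed
  have "\<exists>m\<in>?A. \<forall>h\<in>?A. h \<le> m \<longrightarrow> h = m"
  proof (rule predicate_Zorn)
    show "partial_order_on ?A ?R"
      by (rule partial_order_on_relation_ofI) auto
    fix C assume "C \<in> Chains ?R"
    then have C: "C \<subseteq> ?A" and chain: "\<And>f g. f \<in> C \<Longrightarrow> g \<in> C \<Longrightarrow> f \<le> g \<or> g \<le> f"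
      by (auto simp: Chains_def relation_of_def)
    show "\<exists>g\<in>?A. \<forall>f\<in>C. g \<le> f"
    proof (cases "C = {}")
      case True
      then show ?thesis using K by blast
    next
      case ne: False
      let ?g = "\<lambda>x. INF f\<in>C. f x"
      \<comment> \<open>Convexity and \<open>f 0 = 0\<close> give \<open>- f (- x) \<le> f x\<close>, so an upper bound at \<open>- x\<close> is a lower bound at \<open>x\<close>.\<close>
      have bdd: "bdd_below ((\<lambda>f. f x) ` C)" for x
      proof (rule bdd_belowI2)
        fix f assume "f \<in> C"
        then have f: "convex_on UNIV f" "f 0 = 0" "f \<le> ?K" using C by auto
        have "f ((1 - 1/2) *\<^sub>R x + (1/2) *\<^sub>R (- x)) \<le> (1 - 1/2) * f x + 1/2 * f (- x)"
          by (rule convex_onD[OF f(1)]) auto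
        then have "- f (- x) \<le> f x"
          using f(2) by simp
        moreover have "f (- x) \<le> ?K (- x)"
          using f(3) by (rule le_funD)
        ultimately show "- ?K (- x) \<le> f x" by linarith
      qed
      have low: "\<forall>f\<in>C. ?g \<le> f"
        using bdd by (auto simp: le_fun_def intro: cINF_lower)
      have "convex_on UNIV ?g"
        using ne _ chain bdd by (rule chain_Inf_convex) (use C in auto)
      moreover have "?g 0 = 0"
      proof -
        have "(\<lambda>f. f 0) ` C = {0}" using ne C by auto
        then show ?thesis by simp
      qed
      moreover have "?g \<le> ?K"
      proof -
        obtain f where "f \<in> C" using ne by blast
        then have "?g \<le> f" "f \<le> ?K" using low C by auto
        then show ?thesis by (rule order_trans)
      qed
      ultimately show ?thesis using low by blast
    qed
  qed
  then obtain m where m: "m \<in> ?A" "\<And>h. h \<in> ?A \<Longrightarrow> h \<le> m \<Longrightarrow> h = m" by blast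
  have "linear m"
  proof (rule minimal_convex_linear)
    fix g :: "'v \<Rightarrow> real" assume "convex_on UNIV g" "g 0 = 0" "g \<le> m"
    then show "g = m" using m by (intro m(2)) (auto intro: order_trans)
  qed (use m in auto)
  moreover have "H u + m (v - u) \<le> H v" for v
  proof -
    have "m \<le> ?K" using m(1) by simp
    then have "m (v - u) \<le> ?K (v - u)" by (rule le_funD)
    then show ?thesis by simp
  qed
  ultimately show ?thesis by (rule that)
qed


section \<open>The canonical embedding and Fenchel duality\<close>

lemma convex_on_norm_square: "convex_on UNIV (\<lambda>x. (norm x)\<^sup>2)"
proof (rule convex_onI)
  fix t :: real and x y :: 'a
  assume t: "0 < t" "t < 1"
  have "norm ((1 - t) *\<^sub>R x + t *\<^sub>R y) \<le> (1 - t) * norm x + t * norm y"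
    using t by (intro norm_triangle_le add_mono) auto
  then have "(norm ((1 - t) *\<^sub>R x + t *\<^sub>R y))\<^sup>2 \<le> ((1 - t) * norm x + t * norm y)\<^sup>2"
    by (rule power_mono) simp
  also have "\<dots> \<le> (1 - t) * (norm x)\<^sup>2 + t * (norm y)\<^sup>2"
    using convex_onD[OF convex_power2, of t "norm x" "norm y"] t by simp
  finally show "(norm ((1 - t) *\<^sub>R x + t *\<^sub>R y))\<^sup>2 \<le> (1 - t) * (norm x)\<^sup>2 + t * (norm y)\<^sup>2" .
qed simp

text \<open>
  A subgradient \<open>L\<close> of the norm at \<open>x\<close> is dominated by the norm because
  \<open>\<parallel>x\<parallel> + L v \<le> \<parallel>x + v\<parallel> \<le> \<parallel>x\<parallel> + \<parallel>v\<parallel>\<close>, and testing it at \<open>0\<close> gives \<open>\<parallel>x\<parallel> \<le> L x\<close>.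
\<close>
lemma norming_functional:
  fixes x :: "'a::real_normed_vector"
  obtains x' :: "'a \<Rightarrow>\<^sub>L real" where "norm x' \<le> 1" "blinfun_apply x' x = norm x"
proof -
  have "convex_on UNIV (norm :: 'a \<Rightarrow> real)"
    using convex_on_dist[of UNIV "0::'a"] by simp
  then obtain L where L: "linear L" "\<And>v. norm x + L (v - x) \<le> norm v"
    by (rule convex_subgradient) blast
  have le: "L v \<le> norm v" for v
    using L(2)[of "x + v"] norm_triangle_ineq[of x v] by simp
  have bound: "\<bar>L v\<bar> \<le> norm v" for v
    using le[of v] le[of "- v"] linear_neg[OF L(1), of v] by auto
  have "bounded_linear L"
    using bound by (intro bounded_linear.intro bounded_linear_axioms.intro L(1) exI[of _ 1]) auto
  then have L_apply: "blinfun_apply (Blinfun L) = L"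
    by (rule bounded_linear_Blinfun_apply)
  have "norm x \<le> L x"
    using L(2)[of 0] linear_neg[OF L(1), of x] by simp
  then have "blinfun_apply (Blinfun L) x = norm x"
    using le[of x] L_apply by simp
  moreover have "norm (Blinfun L) \<le> 1"
    using bound L_apply by (intro norm_blinfun_bound) auto
  ultimately show ?thesis using that by blast
qed

lemma canonical_image_apply: "blinfun_apply (canonical_image x) x' = blinfun_apply x' x"
  by (simp add: canonical_image.rep_eq)

lemma norm_canonical_image: "norm (canonical_image x) = norm x"
proof (rule antisym)
  show "norm (canonical_image x) \<le> norm x"
    by (rule norm_blinfun_bound)
      (auto simp: canonical_image_apply mult.commute[of "norm x"] norm_blinfun simp flip: real_norm_def)
  obtain x' :: "'a \<Rightarrow>\<^sub>L real" where x': "norm x' \<le> 1" "blinfun_apply x' x = norm x"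
    by (rule norming_functional)
  have "norm x \<le> norm (canonical_image x) * norm x'"
    using norm_blinfun[of "canonical_image x" x'] x'(2) by (simp add: canonical_image_apply)
  also have "\<dots> \<le> norm (canonical_image x) * 1"
    using x'(1) by (intro mult_left_mono) auto
  finally show "norm x \<le> norm (canonical_image x)" by simp
qed

lemma bounded_linear_canonical_image: "bounded_linear canonical_image"
  by (rule bounded_linear_intro[where K=1])
    (auto intro!: blinfun_eqI simp: canonical_image_apply norm_canonical_image
      blinfun.add_left blinfun.add_right blinfun.scaleR_left blinfun.scaleR_right)

lemma inj_canonical_image: "inj canonical_image"
  using bounded_linear.linear[OF bounded_linear_canonical_image] norm_canonical_image
  by (metis linear_inj_iff_eq_0 norm_eq_zero)

lemma closed_range_canonical_image:
  "closed (range (canonical_image :: 'a::banach \<Rightarrow> _))"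
proof (rule complete_imp_closed)
  show "complete (range (canonical_image :: 'a \<Rightarrow> _))"
    by (rule complete_isometric_image[of 1])
      (auto simp: bounded_linear_canonical_image norm_canonical_image complete_UNIV)
qed

text \<open>
  The functional is a subgradient at \<open>w\<close> of the value function
  \<open>H v = inf\<^sub>z F z + 1/2 \<parallel>v + A z\<parallel>\<^sup>2\<close>, which is convex, being the partial infimum of a jointly convex
  function; the lower bound on \<open>F\<close> keeps it finite.  The term \<open>- 1/2 \<parallel>y'\<parallel>\<^sup>2\<close> appears since
  \<open>1/2 \<parallel>y'\<parallel>\<^sup>2\<close> is the supremum of \<open>y' y - 1/2 \<parallel>y\<parallel>\<^sup>2\<close> over \<open>y\<close>.
\<close>
lemma fenchel_norm_square:
  fixes F :: "'b::real_vector \<Rightarrow> real" and A :: "'b \<Rightarrow> 'a::real_normed_vector"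
  assumes F: "convex_on UNIV F" and bdd: "\<And>z. m \<le> F z"
    and A: "linear A"
    and le: "\<And>z. \<beta> \<le> F z + 1/2 * (norm (w + A z))\<^sup>2"
  obtains y' :: "'a \<Rightarrow>\<^sub>L real"
  where "\<And>z. \<beta> \<le> F z + blinfun_apply y' (w + A z) - 1/2 * (norm y')\<^sup>2"
proof -
  define G where "G v z = F z + 1/2 * (norm (v + A z))\<^sup>2" for v z
  define H where "H v = (INF z. G v z)" for v
  have bddG: "bdd_below (range (G v))" for v
    by (rule bdd_belowI2[of _ m]) (use bdd in \<open>simp add: G_def add_increasing2\<close>)
  have HG: "H v \<le> G v z" for v z
    unfolding H_def using bddG by (rule cINF_lower) simp
  have G: "G ((1 - t) *\<^sub>R v1 + t *\<^sub>R v2) ((1 - t) *\<^sub>R z1 + t *\<^sub>R z2) \<le> (1 - t) * G v1 z1 + t * G v2 z2"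
    if t: "0 < t" "t < 1" for t v1 v2 z1 z2
  proof -
    have "(1 - t) *\<^sub>R v1 + t *\<^sub>R v2 + A ((1 - t) *\<^sub>R z1 + t *\<^sub>R z2)
        = (1 - t) *\<^sub>R (v1 + A z1) + t *\<^sub>R (v2 + A z2)"
      by (simp add: linear_add[OF A] linear_scale[OF A] scaleR_add_right)
    then have "(norm ((1 - t) *\<^sub>R v1 + t *\<^sub>R v2 + A ((1 - t) *\<^sub>R z1 + t *\<^sub>R z2)))\<^sup>2
        \<le> (1 - t) * (norm (v1 + A z1))\<^sup>2 + t * (norm (v2 + A z2))\<^sup>2"
      using convex_onD[OF convex_on_norm_square, of t "v1 + A z1" "v2 + A z2"] t by simp
    moreover have "F ((1 - t) *\<^sub>R z1 + t *\<^sub>R z2) \<le> (1 - t) * F z1 + t * F z2"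
      using convex_onD[OF F, of t z1 z2] t by simp
    ultimately show ?thesis
      unfolding G_def distrib_left by linarith
  qed
  have "convex_on UNIV H"
  proof (rule convex_onI)
    fix t :: real and v1 v2 :: 'a
    assume t: "0 < t" "t < 1"
    let ?v = "(1 - t) *\<^sub>R v1 + t *\<^sub>R v2"
    have mix: "H ?v \<le> (1 - t) * G v1 z1 + t * G v2 z2" for z1 z2
      using G[OF t, of v1 v2 z1 z2] HG[of ?v] by (meson order_trans)
    have "(H ?v - t * G v2 z2) / (1 - t) \<le> H v1" for z2
      unfolding H_def[of v1] using mix[of _ z2] t by (intro cINF_greatest) (auto simp: field_simps)
    then have "(H ?v - (1 - t) * H v1) / t \<le> H v2"
      unfolding H_def[of v2] using t by (intro cINF_greatest) (auto simp: field_simps)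
    then show "H ?v \<le> (1 - t) * H v1 + t * H v2"
      using t by (simp add: field_simps)
  qed simp
  then obtain L where L: "linear L" "\<And>v. H w + L (v - w) \<le> H v"
    by (rule convex_subgradient) blast
  have "\<beta> \<le> H w"
    unfolding H_def G_def by (rule cINF_greatest) (use le in auto)
  then have key: "L y - 1/2 * (norm y)\<^sup>2 \<le> F z + L (w + A z) - \<beta>" for y z
    using L(2)[of "y - A z"] HG[of "y - A z" z]
    by (simp add: G_def linear_add[OF L(1)] linear_diff[OF L(1)])
  \<comment> \<open>Optimising the inequality over the multiples of \<open>y\<close> bounds \<open>L\<close>, and bounds its norm sharply.\<close>
  have square: "(L y)\<^sup>2 \<le> 2 * (F z + L (w + A z) - \<beta>) * (norm y)\<^sup>2" for y z
  proof (cases "y = 0")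
    case False
    define n where "n = (norm y)\<^sup>2"
    have n: "0 < n" using False by (simp add: n_def)
    let ?r = "L y / n"
    have "?r * L y - 1/2 * (?r\<^sup>2 * n) \<le> F z + L (w + A z) - \<beta>"
      using key[of "?r *\<^sub>R y" z]
      by (simp only: linear_scale[OF L(1)] norm_scaleR power_mult_distrib power2_abs real_scaleR_def n_def)
    moreover have "?r * L y - 1/2 * (?r\<^sup>2 * n) = (L y)\<^sup>2 / (2 * n)"
      using n by (simp add: power2_eq_square field_simps)
    ultimately have "(L y)\<^sup>2 / (2 * n) \<le> F z + L (w + A z) - \<beta>" by simp
    then show ?thesis
      using n by (simp add: field_simps flip: n_def)
  qed (simp add: linear_0[OF L(1)])
  have nonneg: "0 \<le> F z + L (w + A z) - \<beta>" for z
    using key[of 0 z] by (simp add: linear_0[OF L(1)])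
  have bound: "norm (L y) \<le> sqrt (2 * (F z + L (w + A z) - \<beta>)) * norm y" for y z
    using real_sqrt_le_mono[OF square[of y z]] by (simp add: real_sqrt_mult)
  have "bounded_linear L"
    using bound[of _ 0] L(1) mult.commute
    by (intro bounded_linear.intro bounded_linear_axioms.intro
        exI[of _ "sqrt (2 * (F 0 + L (w + A 0) - \<beta>))"]) (auto simp: ac_simps)
  then have L_apply: "blinfun_apply (Blinfun L) = L"
    by (rule bounded_linear_Blinfun_apply)
  have "\<beta> \<le> F z + blinfun_apply (Blinfun L) (w + A z) - 1/2 * (norm (Blinfun L))\<^sup>2" for z
  proof -
    have "norm (Blinfun L) \<le> sqrt (2 * (F z + L (w + A z) - \<beta>))"
      using bound[of _ z] nonneg[of z] by (intro norm_blinfun_bound) (auto simp: L_apply)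
    then have "(norm (Blinfun L))\<^sup>2 \<le> 2 * (F z + L (w + A z) - \<beta>)"
      using nonneg[of z] by (metis norm_ge_zero power_mono real_sqrt_pow2 mult_nonneg_nonneg zero_le_numeral)
    then show ?thesis using L_apply by simp
  qed
  then show ?thesis by (rule that)
qed

section \<open>Maximal monotonicity of positive linear maps\<close>

lemma zero_if_quadratic_nonneg:
  fixes a b :: real
  assumes nonneg: "\<And>r. 0 \<le> r * a + r\<^sup>2 * b"
  shows "a = 0"
proof (rule ccontr)
  assume "a \<noteq> 0"
  define c where "c = \<bar>b\<bar> + 1"
  have c: "0 < c" by (simp add: c_def)
  have "0 \<le> - (a / c) * a + (- (a / c))\<^sup>2 * b"
    by (rule nonneg)
  also have "(- (a / c))\<^sup>2 * b \<le> (a / c)\<^sup>2 * (c - 1)"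
    by (simp add: c_def mult_left_mono)
  also have "- (a / c) * a + (a / c)\<^sup>2 * (c - 1) = - (a / c)\<^sup>2"
    using c by (simp add: power2_eq_square field_simps)
  finally show False
    using \<open>a \<noteq> 0\<close> c by simp
qed

lemma maximally_monotone_subsetI:
  assumes "monotone_subset A"
    and related: "\<And>x x'. (\<And>s s'. (s, s') \<in> A \<Longrightarrow> 0 \<le> blinfun_apply (s' - x') (s - x)) \<Longrightarrow> (x, x') \<in> A"
  shows "maximally_monotone_subset A"
  unfolding maximally_monotone_subset_def
proof (intro conjI allI impI)
  fix B assume B: "monotone_subset B \<and> A \<subseteq> B"
  show "B = A"
  proof
    show "B \<subseteq> A"
    proof (rule subrelI)
      fix x x' assume "(x, x') \<in> B"
      then show "(x, x') \<in> A"
        using B by (intro related) (fastforce simp: monotone_subset_def)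
    qed
  qed (use B in simp)
qed (rule assms(1))

text \<open>
  A monotonically related point \<open>(x, x')\<close> is compared with the graph points above \<open>x + r z\<close>.
\<close>
lemma maximally_monotone_linear:
  fixes T :: "'a::banach \<Rightarrow> ('a \<Rightarrow>\<^sub>L real)"
  assumes T: "linear T" and pos: "\<And>x. 0 \<le> blinfun_apply (T x) x"
  shows "maximally_monotone (\<lambda>x. {T x})"
  unfolding maximally_monotone_def
proof (rule maximally_monotone_subsetI)
  show "monotone_subset (multi_graph (\<lambda>x. {T x}))"
    using pos by (auto simp: monotone_subset_def multi_graph_def simp flip: linear_diff[OF T])
next
  fix x x'
  assume rel: "\<And>s s'. (s, s') \<in> multi_graph (\<lambda>x. {T x}) \<Longrightarrow> 0 \<le> blinfun_apply (s' - x') (s - x)"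
  have "blinfun_apply (T x - x') z = 0" for z
  proof (rule zero_if_quadratic_nonneg)
    fix r
    have "0 \<le> blinfun_apply (T (x + r *\<^sub>R z) - x') (x + r *\<^sub>R z - x)"
      by (rule rel) (simp add: multi_graph_def)
    then show "0 \<le> r * blinfun_apply (T x - x') z + r\<^sup>2 * blinfun_apply (T z) z"
      by (simp add: linear_add[OF T] linear_scale[OF T] blinfun.bilinear_simps
          power2_eq_square algebra_simps)
  qed
  then have "T x - x' = 0" by (intro blinfun_eqI) simp
  then show "(x, x') \<in> multi_graph (\<lambda>x. {T x})" by (simp add: multi_graph_def)
qed

lemma multi_graph_inverse: "multi_graph (\<lambda>x. {x'. x = t x'}) = range (\<lambda>x'. (t x', x'))"
  by (auto simp: multi_graph_def)

text \<open>
  The dual version of the preceding argument, along the points \<open>x' + r z'\<close>; it yields that every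
  functional vanishes on \<open>t x' - x\<close>, so a norming functional is needed to conclude.
\<close>
lemma maximally_monotone_inverse_linear:
  fixes t :: "('a::banach \<Rightarrow>\<^sub>L real) \<Rightarrow> 'a"
  assumes t: "linear t" and pos: "\<And>x'. 0 \<le> blinfun_apply x' (t x')"
  shows "maximally_monotone (\<lambda>x. {x'. x = t x'})"
  unfolding maximally_monotone_def multi_graph_inverse
proof (rule maximally_monotone_subsetI)
  show "monotone_subset (range (\<lambda>x'. (t x', x')))"
    using pos by (auto simp: monotone_subset_def simp flip: linear_diff[OF t])
next
  fix x x'
  assume rel: "\<And>s s'. (s, s') \<in> range (\<lambda>x'. (t x', x')) \<Longrightarrow> 0 \<le> blinfun_apply (s' - x') (s - x)"
  have "blinfun_apply z' (t x' - x) = 0" for z' :: "'a \<Rightarrow>\<^sub>L real"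
  proof (rule zero_if_quadratic_nonneg)
    fix r
    have "0 \<le> blinfun_apply ((x' + r *\<^sub>R z') - x') (t (x' + r *\<^sub>R z') - x)"
      by (rule rel) simp
    then show "0 \<le> r * blinfun_apply z' (t x' - x) + r\<^sup>2 * blinfun_apply z' (t z')"
      by (simp add: linear_add[OF t] linear_scale[OF t] blinfun.bilinear_simps
          power2_eq_square algebra_simps)
  qed
  then have "t x' - x = 0"
    using norming_functional[of "t x' - x"] by (metis norm_eq_zero)
  then show "(x, x') \<in> range (\<lambda>x'. (t x', x'))" by auto
qed

section \<open>Quasidensity and the Fitzpatrick extension of the inverse\<close>

text \<open>
  If the infimum at \<open>(x, x')\<close> exceeded some \<open>\<beta> > 0\<close>, then with \<open>w = t x' - x\<close> and \<open>s' = x' + z\<close> the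
  convex function
  \<open>F z = z w + 1/2 \<parallel>z\<parallel>\<^sup>2 + z (t z)\<close> would satisfy \<open>\<beta> \<le> F z + 1/2 \<parallel>w + t z\<parallel>\<^sup>2\<close> for all \<open>z\<close>.  Fenchel duality
  supplies \<open>y'\<close> with \<open>\<beta> \<le> F z + y' (w + t z) - 1/2 \<parallel>y'\<parallel>\<^sup>2\<close>, and at \<open>z = - y'\<close> the right-hand side is \<open>0\<close>.
\<close>
lemma quasidense_inverse_linear:
  fixes t :: "('a::banach \<Rightarrow>\<^sub>L real) \<Rightarrow> 'a"
  assumes t: "linear t" and pos: "\<And>x'. 0 \<le> blinfun_apply x' (t x')"
  shows "quasidense (\<lambda>x. {x'. x = t x'})"
  unfolding quasidense_def multi_graph_inverse
proof (intro allI)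
  fix x :: 'a and x' :: "'a \<Rightarrow>\<^sub>L real"
  let ?val = "\<lambda>s s'. 1/2 * (norm (s - x))\<^sup>2 + 1/2 * (norm (s' - x'))\<^sup>2 + blinfun_apply (s' - x') (s - x)"
  let ?inf = "INF (s, s') \<in> range (\<lambda>x'. (t x', x')). ereal (?val s s')"
  show "?inf \<le> 0"
  proof (rule ccontr)
    assume "\<not> ?inf \<le> 0"
    then have "0 < ?inf" by simp
    then obtain \<beta> where \<beta>: "0 < ereal \<beta>" "ereal \<beta> < ?inf"
      using ereal_dense2 by blast
    define w where "w = t x' - x"
    define F where "F z = (blinfun_apply z w + 1/2 * (norm z)\<^sup>2) + blinfun_apply z (t z)" for z
    have val: "\<beta> \<le> F z + 1/2 * (norm (w + t z))\<^sup>2" for z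
    proof -
      have "?inf \<le> ereal (?val (t (x' + z)) (x' + z))"
        by (rule INF_lower2[of "(t (x' + z), x' + z)"]) auto
      then have "ereal \<beta> < ereal (?val (t (x' + z)) (x' + z))"
        using \<beta>(2) by (rule less_le_trans[rotated])
      then show ?thesis
        by (simp add: F_def w_def linear_add[OF t] blinfun.bilinear_simps algebra_simps)
    qed
    have bdd: "- (1/2 * (norm w)\<^sup>2) \<le> F z" for z
    proof -
      have "\<bar>blinfun_apply z w\<bar> \<le> norm z * norm w"
        using norm_blinfun[of z w] by simp
      moreover have "norm z * norm w \<le> 1/2 * (norm z)\<^sup>2 + 1/2 * (norm w)\<^sup>2"
        using sum_squares_bound[of "norm z" "norm w"] by simp
      ultimately show ?thesis
        using pos[of z] unfolding F_def by linarith
    qed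
    have "convex_on UNIV (\<lambda>z. blinfun_apply z w)"
      by (rule convex_onI) (simp_all add: blinfun.bilinear_simps)
    moreover have "convex_on UNIV (\<lambda>z::'a \<Rightarrow>\<^sub>L real. 1/2 * (norm z)\<^sup>2)"
      by (rule convex_on_cmul[OF _ convex_on_norm_square]) simp
    \<comment> \<open>A nonnegative quadratic form \<open>q\<close> is convex: the defect at the parameter \<open>r\<close> is \<open>r (1 - r) q (y - z)\<close>.\<close>
    moreover have "convex_on UNIV (\<lambda>z. blinfun_apply z (t z))"
    proof (rule convex_onI)
      fix r :: real and y z :: "'a \<Rightarrow>\<^sub>L real"
      assume r: "0 < r" "r < 1"
      let ?m = "(1 - r) *\<^sub>R y + r *\<^sub>R z"
      have "(1 - r) * blinfun_apply y (t y) + r * blinfun_apply z (t z) - blinfun_apply ?m (t ?m)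
          = r * (1 - r) * blinfun_apply (y - z) (t (y - z))"
        by (simp add: linear_add[OF t] linear_diff[OF t] linear_scale[OF t]
            blinfun.bilinear_simps algebra_simps)
      also have "\<dots> \<ge> 0"
        using r pos[of "y - z"] by simp
      finally show "blinfun_apply ?m (t ?m) \<le> (1 - r) * blinfun_apply y (t y) + r * blinfun_apply z (t z)"
        by simp
    qed simp
    ultimately have "convex_on UNIV F"
      unfolding F_def by (intro convex_on_add)
    then obtain y' where y': "\<And>z. \<beta> \<le> F z + blinfun_apply y' (w + t z) - 1/2 * (norm y')\<^sup>2"
      by (rule fenchel_norm_square[of F, OF _ bdd t val]) blast
    have "\<beta> \<le> 0"
      using y'[of "- y'"]
      by (simp add: F_def linear_neg[OF t] blinfun.bilinear_simps)
    then show False using \<beta>(1) by simp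
  qed
qed

text \<open>
  By monotonicity, the Fitzpatrick function at a graph point \<open>(t s', s')\<close> is at most \<open>s' (t s')\<close>.  Hence the conjugate at
  \<open>(y', y'')\<close> is at least \<open>y' (t s') + y'' s' - s' (t s')\<close> for every \<open>s'\<close>.  When the conjugate equals
  \<open>y'' y'\<close>, putting \<open>s' = y' + r z\<close> leaves a nonnegative quadratic in \<open>r\<close> without constant term, so \<open>y''\<close> is the
  canonical image of \<open>t y'\<close>.  Conversely, for this \<open>y''\<close>, the graph point \<open>(t y', y')\<close>
  in the Fitzpatrick function bounds the conjugate from above by \<open>y' (t y')\<close>.
\<close>
lemma fitzpatrick_extension_inverse_linear:
  fixes t :: "('a::banach \<Rightarrow>\<^sub>L real) \<Rightarrow> 'a"
  assumes t: "linear t" and pos: "\<And>x'. 0 \<le> blinfun_apply x' (t x')"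
  shows "fitzpatrick_extension (\<lambda>x. {x'. x = t x'}) = (\<lambda>y'. {canonical_image (t y')})"
proof -
  let ?\<phi> = "fitzpatrick (\<lambda>x. {x'. x = t x'})"
  have \<phi>: "?\<phi> (x, x') = (SUP s'. ereal (blinfun_apply x' (t s') + blinfun_apply s' x - blinfun_apply s' (t s')))"
    for x x'
    unfolding fitzpatrick_def multi_graph_inverse by (simp add: image_image)
  have \<phi>_graph: "?\<phi> (t s', s') \<le> ereal (blinfun_apply s' (t s'))" for s'
    unfolding \<phi>
  proof (rule SUP_least)
    fix r'
    have "0 \<le> blinfun_apply (s' - r') (t (s' - r'))" by (rule pos)
    then show "ereal (blinfun_apply s' (t r') + blinfun_apply r' (t s') - blinfun_apply r' (t r'))
        \<le> ereal (blinfun_apply s' (t s'))"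
      by (simp add: linear_diff[OF t] blinfun.bilinear_simps)
  qed
  have conj_ge: "ereal (blinfun_apply y' (t s') + blinfun_apply y'' s' - blinfun_apply s' (t s'))
      \<le> conjugate ?\<phi> (y', y'')" for y' y'' s'
    unfolding conjugate_def prod.case
  proof (rule SUP_upper2[of "(t s', s')"])
    show "ereal (blinfun_apply y' (t s') + blinfun_apply y'' s' - blinfun_apply s' (t s'))
      \<le> (case (t s', s') of (x, x') \<Rightarrow> ereal (blinfun_apply y' x + blinfun_apply y'' x') - ?\<phi> (x, x'))"
      using ereal_minus_mono[OF order_refl \<phi>_graph[of s'],
          of "ereal (blinfun_apply y' (t s') + blinfun_apply y'' s')"] by simp
  qed simp
  have "conjugate ?\<phi> (y', canonical_image (t y')) = ereal (blinfun_apply y' (t y'))" for y'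
  proof (rule antisym)
    show "conjugate ?\<phi> (y', canonical_image (t y')) \<le> ereal (blinfun_apply y' (t y'))"
      unfolding conjugate_def prod.case
    proof (rule SUP_least, clarify)
      fix x :: 'a and x' :: "'a \<Rightarrow>\<^sub>L real"
      have "ereal (blinfun_apply x' (t y') + blinfun_apply y' x - blinfun_apply y' (t y')) \<le> ?\<phi> (x, x')"
        unfolding \<phi> by (rule SUP_upper) simp
      from ereal_minus_mono[OF order_refl this,
          of "ereal (blinfun_apply y' x + blinfun_apply (canonical_image (t y')) x')"]
      show "ereal (blinfun_apply y' x + blinfun_apply (canonical_image (t y')) x') - ?\<phi> (x, x')
          \<le> ereal (blinfun_apply y' (t y'))"
        by (simp add: canonical_image_apply)
    qed
    show "ereal (blinfun_apply y' (t y')) \<le> conjugate ?\<phi> (y', canonical_image (t y'))"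
      using conj_ge[of y' y' "canonical_image (t y')"] by (simp add: canonical_image_apply)
  qed
  moreover have "y'' = canonical_image (t y')"
    if y'': "conjugate ?\<phi> (y', y'') = ereal (blinfun_apply y'' y')" for y' y''
  proof -
    have "blinfun_apply (canonical_image (t y') - y'') z = 0" for z
    proof (rule zero_if_quadratic_nonneg)
      fix r
      have "blinfun_apply y' (t (y' + r *\<^sub>R z)) + blinfun_apply y'' (y' + r *\<^sub>R z)
          - blinfun_apply (y' + r *\<^sub>R z) (t (y' + r *\<^sub>R z)) \<le> blinfun_apply y'' y'"
        using conj_ge[of y' "y' + r *\<^sub>R z" y''] y'' by simp
      then show "0 \<le> r * blinfun_apply (canonical_image (t y') - y'') z + r\<^sup>2 * blinfun_apply z (t z)"
        by (simp add: linear_add[OF t] linear_scale[OF t] blinfun.bilinear_simps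
            canonical_image_apply power2_eq_square algebra_simps)
    qed
    then have "canonical_image (t y') - y'' = 0" by (intro blinfun_eqI) simp
    then show ?thesis by simp
  qed
  ultimately show ?thesis
    by (auto simp: fitzpatrick_extension_def fun_eq_iff canonical_image_apply)
qed

section \<open>Failure of quasidensity\<close>

text \<open>
  Let \<open>d\<close> be the distance from \<open>e\<close> to \<open>M\<close> and \<open>u = - K (e - v)\<close> with \<open>v \<in> M\<close> almost nearest to \<open>e\<close>.
  Modulo \<open>M\<close>, the point \<open>e - u\<close> is \<open>(1 + K) e\<close>, at distance \<open>(1 + K) d\<close> from \<open>M\<close>, while the norm of \<open>u\<close>
  is about \<open>K d\<close>.  The squares differ by about \<open>(1 + 2 K) d\<^sup>2\<close>, which is arbitrarily large; the choice
  \<open>K = 1 / d\<^sup>2\<close> leaves room for an error \<open>1\<close> in the square of the norm of \<open>u\<close>.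
\<close>
lemma far_point_from_closed_subspace:
  fixes M :: "'a::real_normed_vector set"
  assumes M: "subspace M" "closed M" and e: "e \<notin> M"
  obtains u where "\<And>m. m \<in> M \<Longrightarrow> (norm u)\<^sup>2 + 1 \<le> (norm (e - u - m))\<^sup>2"
proof -
  have ne: "M \<noteq> {}" using subspace_0[OF M(1)] by blast
  define d where "d = infdist e M"
  have d: "0 < d" unfolding d_def using M(2) ne e by (rule infdist_pos_not_in_closed)
  have dle: "d \<le> norm (e - m)" if "m \<in> M" for m
    using infdist_le[OF that, of e] by (simp add: d_def dist_norm)
  define K where "K = 1 / d\<^sup>2"
  have K: "0 < K" "K * d\<^sup>2 = 1" using d by (auto simp: K_def)
  have "d < sqrt (d\<^sup>2 + 1 / K\<^sup>2)"
    using d K by (intro real_less_rsqrt) simp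
  then have "\<exists>v\<in>M. norm (e - v) < sqrt (d\<^sup>2 + 1 / K\<^sup>2)"
    unfolding d_def infdist_notempty[OF ne] dist_norm using ne
    by (subst (asm) cInf_less_iff) (auto intro: bdd_belowI[of _ 0])
  then obtain v where v: "v \<in> M" "norm (e - v) < sqrt (d\<^sup>2 + 1 / K\<^sup>2)" by blast
  have "(norm (e - v))\<^sup>2 \<le> (sqrt (d\<^sup>2 + 1 / K\<^sup>2))\<^sup>2"
    using v(2) by (intro power_mono) auto
  then have v2: "(norm (e - v))\<^sup>2 \<le> d\<^sup>2 + 1 / K\<^sup>2"
    by simp
  have "(norm (- K *\<^sub>R (e - v)))\<^sup>2 + 1 \<le> (norm (e - (- K *\<^sub>R (e - v)) - m))\<^sup>2" if m: "m \<in> M" for m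
  proof -
    let ?n = "(1 / (1 + K)) *\<^sub>R (K *\<^sub>R v + m)"
    have "?n \<in> M"
      using M(1) v(1) m by (simp add: subspace_add subspace_scale)
    then have "(1 + K) * d \<le> (1 + K) * norm (e - ?n)"
      using dle K by (intro mult_left_mono) auto
    also have "\<dots> = norm ((1 + K) *\<^sub>R (e - ?n))"
      using K by simp
    also have "(1 + K) *\<^sub>R (e - ?n) = (1 + K) *\<^sub>R e - (K *\<^sub>R v + m)"
      using K by (simp add: scaleR_diff_right)
    also have "\<dots> = e - (- K *\<^sub>R (e - v)) - m"
      by (simp add: algebra_simps)
    finally have "((1 + K) * d)\<^sup>2 \<le> (norm (e - (- K *\<^sub>R (e - v)) - m))\<^sup>2"
      using K d by (intro power_mono) auto
    moreover have "((1 + K) * d)\<^sup>2 = d\<^sup>2 + 2 + K\<^sup>2 * d\<^sup>2"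
      using K(2) by (simp add: power2_eq_square algebra_simps)
    moreover have "(norm (- K *\<^sub>R (e - v)))\<^sup>2 \<le> K\<^sup>2 * d\<^sup>2 + 1"
    proof -
      have "(norm (- K *\<^sub>R (e - v)))\<^sup>2 = K\<^sup>2 * (norm (e - v))\<^sup>2"
        using K by (simp add: power_mult_distrib)
      also have "\<dots> \<le> K\<^sup>2 * (d\<^sup>2 + 1 / K\<^sup>2)"
        using v2 by (intro mult_left_mono) auto
      also have "\<dots> = K\<^sup>2 * d\<^sup>2 + 1"
        using K by (simp add: field_simps)
      finally show ?thesis .
    qed
    ultimately show ?thesis
      using zero_le_power2[of d] by linarith
  qed
  then show ?thesis by (rule that)
qed


text \<open>
  At the point \<open>(0, e - u)\<close> the bracket in the definition of quasidensity splits into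
  \<open>1/2 \<parallel>z\<parallel>\<^sup>2 + u z + 1/2 \<parallel>u\<parallel>\<^sup>2 \<ge> 0\<close>, the square completion \<open>(e z)\<^sup>2 - e z \<ge> - 1/4\<close>, and
  \<open>1/2 (\<parallel>T z - (e - u)\<parallel>\<^sup>2 - \<parallel>u\<parallel>\<^sup>2) \<ge> 1/2\<close>.
\<close>
lemma not_quasidense_into_closed_subspace:
  fixes T :: "'a::banach \<Rightarrow> ('a \<Rightarrow>\<^sub>L real)"
  assumes M: "subspace M" "closed M" and e: "e \<notin> M" and T_M: "range T \<subseteq> M"
    and T_e: "\<And>x. blinfun_apply (T x) x = (blinfun_apply e x)\<^sup>2"
  shows "\<not> quasidense (\<lambda>x. {T x})"
proof
  assume "quasidense (\<lambda>x. {T x})"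
  obtain u where u: "\<And>m. m \<in> M \<Longrightarrow> (norm u)\<^sup>2 + 1 \<le> (norm (e - u - m))\<^sup>2"
    using M e by (rule far_point_from_closed_subspace) blast
  let ?val = "\<lambda>s s'. 1/2 * (norm (s - 0))\<^sup>2 + 1/2 * (norm (s' - (e - u)))\<^sup>2
    + blinfun_apply (s' - (e - u)) (s - 0)"
  have val: "1/4 \<le> ?val z (T z)" for z
  proof -
    have "(norm u)\<^sup>2 + 1 \<le> (norm (T z - (e - u)))\<^sup>2"
      using u[of "T z"] T_M norm_minus_commute[of "T z" "e - u"] by auto
    moreover have "\<bar>blinfun_apply u z\<bar> \<le> 1/2 * (norm u)\<^sup>2 + 1/2 * (norm z)\<^sup>2"
      using norm_blinfun[of u z] sum_squares_bound[of "norm u" "norm z"] by simp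
    moreover have "- (1/4) \<le> (blinfun_apply e z)\<^sup>2 - blinfun_apply e z"
      using zero_le_power2[of "blinfun_apply e z - 1/2"] by (simp add: power2_eq_square algebra_simps)
    ultimately show ?thesis
      using T_e[of z] by (simp add: blinfun.bilinear_simps)
  qed
  have "ereal (1/4) \<le> (INF (s, s') \<in> multi_graph (\<lambda>x. {T x}). ereal (?val s s'))"
  proof (rule INF_greatest, clarify)
    fix s s' assume "(s, s') \<in> multi_graph (\<lambda>x. {T x})"
    then show "ereal (1/4) \<le> ereal (?val s s')"
      using val[of s] by (simp add: multi_graph_def)
  qed
  also have "\<dots> \<le> 0"
    using \<open>quasidense (\<lambda>x. {T x})\<close> unfolding quasidense_def by blast
  finally show False by simp
qed

section \<open>The Fitzpatrick extension need not be quasidense\<close>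

theorem theorem11p4:
  fixes e :: "('a::banach \<Rightarrow>\<^sub>L real) \<Rightarrow>\<^sub>L real"
    and T :: "('a \<Rightarrow>\<^sub>L real) \<Rightarrow> (('a \<Rightarrow>\<^sub>L real) \<Rightarrow>\<^sub>L real)"
    and S :: "'a \<Rightarrow> ('a \<Rightarrow>\<^sub>L real) set"
  assumes nonzero: "\<exists>x::'a. x \<noteq> 0"
    and e: "e \<notin> range canonical_image"
    and linear: "linear T"
    and range_T: "range T \<subseteq> range canonical_image"
    and T_e: "\<And>x'. blinfun_apply (T x') x' = (blinfun_apply e x')\<^sup>2"
    and S: "\<And>x x'. x' \<in> S x \<longleftrightarrow> canonical_image x = T x'"
  shows "(maximally_monotone S \<and> quasidense S \<and> fitzpatrick_extension S = (\<lambda>y'. {T y'}))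
    \<and> (maximally_monotone (fitzpatrick_extension S) \<and> \<not> quasidense (fitzpatrick_extension S))"
proof -
  have lin: "linear (canonical_image :: 'a \<Rightarrow> _)"
    using bounded_linear_canonical_image by (rule bounded_linear.linear)
  have "\<forall>x'. \<exists>x. T x' = canonical_image x"
    using range_T by blast
  then obtain t where T: "T x' = canonical_image (t x')" for x'
    by (auto dest: choice)
  have t: "linear t"
  proof (rule linearI)
    fix x y r
    have "canonical_image (t (x + y)) = canonical_image (t x + t y)"
      using linear_add[OF linear, of x y] by (simp add: T linear_add[OF lin])
    then show "t (x + y) = t x + t y" by (rule injD[OF inj_canonical_image])
    have "canonical_image (t (r *\<^sub>R x)) = canonical_image (r *\<^sub>R t x)"
      using linear_scale[OF linear, of r x] by (simp add: T linear_scale[OF lin])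
    then show "t (r *\<^sub>R x) = r *\<^sub>R t x" by (rule injD[OF inj_canonical_image])
  qed
  have pos: "0 \<le> blinfun_apply x' (t x')" for x'
    using T_e[of x'] by (simp add: T canonical_image_apply)
  have S_eq: "S = (\<lambda>x. {x'. x = t x'})"
    using S by (auto simp: T inj_eq[OF inj_canonical_image])
  have ext: "fitzpatrick_extension S = (\<lambda>y'. {T y'})"
    unfolding S_eq T using t pos by (rule fitzpatrick_extension_inverse_linear)
  have "maximally_monotone (\<lambda>y'. {T y'})"
    using linear by (rule maximally_monotone_linear) (simp add: T_e)
  moreover have "\<not> quasidense (\<lambda>y'. {T y'})"
    using linear_subspace_image[OF lin subspace_UNIV] closed_range_canonical_image e range_T T_e
    by (rule not_quasidense_into_closed_subspace)
  moreover have "maximally_monotone S" "quasidense S"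
    unfolding S_eq using t pos
    by (auto intro: maximally_monotone_inverse_linear quasidense_inverse_linear)
  ultimately show ?thesis using ext by simp
qed

end
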